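(* For every $n\in\mathbb{N}$ the following relations hold in $U$: $$[(xxyy)^nxxy,x]_q=0,$$ $$[x,(yyxx)^nyyx]_q=(q-q^{-3})\left(xyy(xxyy)^nx-(yyxx)^{n+1}\right),$$ $$[(xxyy)^nx,x]_q=(q^3-q^{-1})(xxyy)^nxx,$$ $$[x,(yyxx)^ny]_q=(q-q^{-3})x(yyxx)^ny.$$
   Context: Let $\mathbb{F}$ be a field of characteristic zero and let $q\in\mathbb{F}$ be nonzero and not a root of unity; $\mathbb{N}=\{0,1,2,\ldots\}$. Let $\mathbb{V}$ be the free associative unital $\mathbb{F}$-algebra on two noncommuting generators (letters) $x,y$; the words in $x,y$ (including the trivial word $\mathbf{1}$) form a basis of $\mathbb{V}$. Words such as $(xxyy)^nx$ are written with respect to the free (concatenation) product. The $q$-shuffle product $\star$ on the vector space $\mathbb{V}$ is the bilinear associative product with unit $\mathbf{1}$ determined as follows. Put $\langle x,x\rangle=\langle y,y\rangle=2$ and $\langle x,y\rangle=\langle y,x\rangle=-2$. For nontrivial words $u=u_1\cdots u_r$ and $v=v_1\cdots v_s$, $$u\star v=u_1\big((u_2\cdots u_r)\star v\big)+v_1\big(u\star(v_2\cdots v_s)\big)q^{\langle v_1,u_1\rangle+\cdots+\langle v_1,u_r\rangle}.$$ $U$ denotes the subalgebra of $(\mathbb{V},\star)$ generated by $x,y$; all the words in the statement lie in $U$. The $q$-commutator is taken with respect to $\star$: $[X,Y]_q=qX\star Y-q^{-1}Y\star X$. *)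

theory Defs
  imports Complex_Main "HOL-Library.Poly_Mapping"
begin

text \<open>
  Words under concatenation form a monoid, written additively because
  \<open>Poly_Mapping\<close> builds the monoid algebra over an additive monoid of exponents.
\<close>

instantiation list :: (type) monoid_add
begin

definition zero_list :: "'a list" where "zero_list = []"

definition plus_list :: "'a list \<Rightarrow> 'a list \<Rightarrow> 'a list" where "plus_list = append"

instance
  by standard (simp_all add: zero_list_def plus_list_def)

end

datatype letter = X | Y

text \<open>
  The free associative unital algebra on two noncommuting letters over \<open>'a\<close>, as the monoid
  algebra of the words.  Its ring multiplication \<open>*\<close> (hence also \<open>^\<close>) is
  the free (concatenation) product, not the $q$-shuffle product.
\<close>

type_synonym 'a freealg = "letter list \<Rightarrow>\<^sub>0 'a"

definition word :: "letter list \<Rightarrow> 'a::field freealg"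
  where "word w = Poly_Mapping.single w 1"

abbreviation gen_x :: "'a::field freealg"  (\<open>\<^bold>x\<close>)
  where "\<^bold>x \<equiv> word [X]"

abbreviation gen_y :: "'a::field freealg"  (\<open>\<^bold>y\<close>)
  where "\<^bold>y \<equiv> word [Y]"

definition smult :: "'a::field \<Rightarrow> 'a freealg \<Rightarrow> 'a freealg"  (infixr \<open>\<cdot>\<close> 72)
  where "c \<cdot> v = Poly_Mapping.map ((*) c) v"

lemma word_Nil: "word [] = 1"
  by (simp add: word_def zero_list_def flip: single_one)

lemma word_append: "word (u @ v) = word u * word v"
  by (simp add: word_def mult_single plus_list_def)

definition pairing :: "letter \<Rightarrow> letter \<Rightarrow> int"
  where "pairing a b = (if a = b then 2 else - 2)"

fun shuffle_words :: "'a::field \<Rightarrow> letter list \<Rightarrow> letter list \<Rightarrow> 'a freealg" where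
  "shuffle_words q [] v = word v"
| "shuffle_words q u [] = word u"
| "shuffle_words q (a # u) (b # v) =
     word [a] * shuffle_words q u (b # v)
     + q powi (\<Sum>c\<leftarrow>a # u. pairing b c) \<cdot> (word [b] * shuffle_words q (a # u) v)"

text \<open>The bilinear extension of \<^const>\<open>shuffle_words\<close>.\<close>

definition qshuffle :: "'a::field \<Rightarrow> 'a freealg \<Rightarrow> 'a freealg \<Rightarrow> 'a freealg"
  where "qshuffle q f g =
    (\<Sum>u\<in>Poly_Mapping.keys f. \<Sum>v\<in>Poly_Mapping.keys g.
       (Poly_Mapping.lookup f u * Poly_Mapping.lookup g v) \<cdot> shuffle_words q u v)"

definition qcommutator :: "'a::field \<Rightarrow> 'a freealg \<Rightarrow> 'a freealg \<Rightarrow> 'a freealg"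
  where "qcommutator q f g = q \<cdot> qshuffle q f g - inverse q \<cdot> qshuffle q g f"

text \<open>The unital subalgebra generated by the two letters with respect to the $q$-shuffle product.\<close>

inductive_set U :: "'a::field \<Rightarrow> 'a freealg set" for q :: 'a where
  one: "1 \<in> U q"
| gen_x: "\<^bold>x \<in> U q"
| gen_y: "\<^bold>y \<in> U q"
| add: "f \<in> U q \<Longrightarrow> g \<in> U q \<Longrightarrow> f + g \<in> U q"
| smult: "f \<in> U q \<Longrightarrow> c \<cdot> f \<in> U q"
| qshuffle: "f \<in> U q \<Longrightarrow> g \<in> U q \<Longrightarrow> qshuffle q f g \<in> U q"

end

theory Submission
  imports Defs
begin

text \<open>
  Membership in \<open>U\<close> is an antipode argument.  For every word \<open>w\<close> of length \<open>n > 0\<close>, the alternating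
  sum of the shuffles \<open>rev u \<star> v\<close> over the factorisations \<open>w = u @ v\<close>, weighted by powers of \<open>q\<close>,
  vanishes.  If all shorter words in sight lie in \<open>U\<close>, its two extreme terms give
  \<open>w + (-1)\<^sup>n q\<^sup>e rev w \<in> U\<close> with \<open>e = (a - b)\<^sup>2 - (a + b)\<close>, where \<open>a\<close> and \<open>b\<close> count the letters
  \<open>x\<close> and \<open>y\<close>.  The same holds for \<open>rev w\<close>, with the same \<open>e\<close>, so \<open>w \<in> U\<close> as soon as \<open>e \<noteq> 0\<close>.
  Words whose letters two apart differ are closed under factors and reversal and satisfy \<open>e \<noteq> 0\<close>
  from length 2 on; all words of the theorem are of this kind.  The four relations follow by
  splitting off one block of four letters at a time.
\<close>

section \<open>Scalar multiples and words in the free algebra\<close>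

lemma lookup_smult [simp]: "Poly_Mapping.lookup (c \<cdot> f) k = c * Poly_Mapping.lookup f k"
  by (simp add: smult_def Poly_Mapping.map.rep_eq when_def)

lemma smult_one [simp]: "1 \<cdot> f = f"
  and smult_zero [simp]: "0 \<cdot> f = 0"
  and smult_smult: "c \<cdot> d \<cdot> f = (c * d) \<cdot> f"
  and smult_diff: "c \<cdot> (f - g) = c \<cdot> f - c \<cdot> g"
  by (rule poly_mapping_eqI; simp add: lookup_add lookup_minus algebra_simps)+

lemma smult_conv_mult: "c \<cdot> f = Poly_Mapping.single 0 c * f"
  by (simp add: smult_def mult_map_scale_conv_mult)

lemma word_mult_smult: "word w * (c \<cdot> f) = c \<cdot> (word w * f)"
proof -
  have "word w * Poly_Mapping.single 0 c = Poly_Mapping.single 0 c * word w"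
    by (simp add: word_def mult_single)
  then show ?thesis
    by (simp add: smult_conv_mult flip: mult.assoc)
qed

lemma word_power: "word w ^ n = word (concat (replicate n w))"
  by (induction n) (simp_all add: word_Nil word_append)

lemma shuffle_words_Nil_right [simp]: "shuffle_words q u [] = word u"
  by (cases u) simp_all

lemma qshuffle_word: "qshuffle q (word u) (word v) = shuffle_words q u v"
  by (simp add: qshuffle_def word_def)

lemma U_diff: "f - g \<in> U q" if "f \<in> U q" "g \<in> U q"
proof -
  have "f - g = f + (-1) \<cdot> g"
    by (rule poly_mapping_eqI) (simp add: lookup_add lookup_minus)
  then show ?thesis
    using U.add[OF that(1) U.smult[OF that(2), of "- 1"]] by (simp only:)
qed

section \<open>Weights of words and the antipode relation\<close>

definition letter_sign :: "letter \<Rightarrow> int"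
  where "letter_sign a = (if a = X then 1 else - 1)"

definition weight :: "letter list \<Rightarrow> int"
  where "weight w = (\<Sum>a\<leftarrow>w. letter_sign a)"

text \<open>The sum of \<open>pairing a b\<close> over all pairs of positions of the word.\<close>

definition pair_weight :: "letter list \<Rightarrow> int"
  where "pair_weight w = (weight w)\<^sup>2 - int (length w)"

lemma weight_simps [simp]:
  "weight [] = 0" "weight (a # w) = letter_sign a + weight w"
  "weight (u @ v) = weight u + weight v" "weight (rev w) = weight w"
  by (simp_all add: weight_def rev_map[symmetric])

lemma pairing_simps [simp]:
  "pairing a a = 2" "pairing X Y = - 2" "pairing Y X = - 2"
  by (simp_all add: pairing_def)

text \<open>The form has rank one: \<open>pairing b c\<close> is twice the product of the two signs.
  Hence every power of \<open>q\<close> in a shuffle is governed by weights alone.\<close>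

lemma sum_pairing: "(\<Sum>c\<leftarrow>w. pairing b c) = 2 * letter_sign b * weight w"
proof (induction w)
  case (Cons a w)
  then show ?case
    by (cases a; cases b) (simp_all add: pairing_def letter_sign_def)
qed simp

lemma pair_weight_Cons: "pair_weight (b # w) = pair_weight w + (\<Sum>c\<leftarrow>w. pairing b c)"
  by (cases b) (simp_all add: pair_weight_def sum_pairing letter_sign_def power2_eq_square algebra_simps)

lemma pair_weight_rev: "pair_weight (rev w) = pair_weight w"
  by (simp add: pair_weight_def)

text \<open>
  The alternating sum telescopes along the recursion of \<^const>\<open>shuffle_words\<close>.  The generalisation
  over \<open>u\<close> is needed for the induction; the antipode relation for \<open>w = a # v\<close> is the case \<open>u = []\<close>.
\<close>

lemma antipode_mod_U:
  fixes q :: "'a::field"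
  assumes "q \<noteq> 0"
    and "\<And>k. k < length v \<Longrightarrow> shuffle_words q (rev (take k v) @ a # u) (drop k v) \<in> U q"
  shows "q powi pair_weight (a # u) \<cdot> (word [a] * shuffle_words q u v)
    - ((-1) ^ length v * q powi pair_weight (rev v @ a # u)) \<cdot> word (rev v @ a # u) \<in> U q"
  using assms(2)
proof (induction v arbitrary: a u)
  case Nil
  have "(0 :: 'a freealg) \<in> U q"
    using U.smult[OF U.one, of 0 q] by simp
  then show ?case
    by (simp flip: word_append)
next
  case (Cons b v)
  let ?w = "rev v @ b # a # u"
  \<comment> \<open>The second summand of the shuffle recursion has the shape of the goal again,
    with \<open>b\<close> and \<open>a # u\<close> in place of \<open>a\<close> and
    \<open>u\<close>.\<close>
  have tail: "q powi pair_weight (b # a # u) \<cdot> (word [b] * shuffle_words q (a # u) v)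
    - ((-1) ^ length v * q powi pair_weight ?w) \<cdot> word ?w \<in> U q" (is "?t \<in> _")
  proof (rule Cons.IH)
    fix k assume "k < length v"
    then show "shuffle_words q (rev (take k v) @ b # a # u) (drop k v) \<in> U q"
      using Cons.prems[of "Suc k"] by simp
  qed
  have head: "shuffle_words q (a # u) (b # v) \<in> U q"
    using Cons.prems[of 0] by simp
  \<comment> \<open>The twist in the recursion is exactly the increment of
    \<open>pair_weight\<close>; this makes the sum telescope.\<close>
  have "q powi pair_weight (b # a # u)
      = q powi pair_weight (a # u) * q powi (\<Sum>c\<leftarrow>a # u. pairing b c)"
    unfolding pair_weight_Cons[of b] using assms(1) by (simp add: power_int_add)
  then have "q powi pair_weight (a # u) \<cdot> (word [a] * shuffle_words q u (b # v))
      - ((-1) ^ length (b # v) * q powi pair_weight (rev (b # v) @ a # u)) \<cdot> word (rev (b # v) @ a # u)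
    = q powi pair_weight (a # u) \<cdot> shuffle_words q (a # u) (b # v) - ?t"
    by (intro poly_mapping_eqI) (simp add: lookup_add lookup_minus algebra_simps)
  also have "\<dots> \<in> U q"
    by (intro U_diff U.smult head tail)
  finally show ?case .
qed

section \<open>Membership of words in \<open>U\<close>\<close>

lemma powi_neq_1:
  fixes q :: "'a::field"
  assumes "\<And>k::nat. k > 0 \<Longrightarrow> q ^ k \<noteq> 1" "m \<noteq> 0"
  shows "q powi m \<noteq> 1"
proof (cases "m > 0")
  case True
  then show ?thesis
    using assms(1)[of "nat m"] by (simp add: power_int_def)
next
  case False
  then show ?thesis
    using assms(1)[of "nat (- m)"] assms(2) by (simp add: power_int_def power_inverse)
qed

lemma word_in_U:
  fixes q :: "'a::field"
  assumes q: "q \<noteq> 0" "\<And>k::nat. k > 0 \<Longrightarrow> q ^ k \<noteq> 1"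
    and closed: "\<And>w k. w \<in> W \<Longrightarrow> take k w \<in> W" "\<And>w k. w \<in> W \<Longrightarrow> drop k w \<in> W"
      "\<And>w. w \<in> W \<Longrightarrow> rev w \<in> W"
    and nonzero: "\<And>w. w \<in> W \<Longrightarrow> 2 \<le> length w \<Longrightarrow> pair_weight w \<noteq> 0"
    and "w \<in> W"
  shows "word w \<in> U q"
  using \<open>w \<in> W\<close>
proof (induction w rule: length_induct)
  case (1 w)
  consider "w = []" | a where "w = [a]" | "2 \<le> length w"
    \<comment> \<open>This rule only supplies the split into no letter, one letter, at least two
      letters.\<close>
    by (cases w rule: remdups_adj.cases) auto
  then show ?case
  proof cases
    case 1
    then show ?thesis
      by (simp add: word_Nil U.one)
  next
    case 2
    then show ?thesis
      by (cases a) (simp_all add: U.gen_x U.gen_y)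
  next
    case 3
    define c where "c = (-1) ^ (length w - 1) * q powi pair_weight w"
    \<comment> \<open>Stated for all \<open>v\<close> as long as \<open>w\<close>, since both
      \<open>w\<close> and \<open>rev w\<close> are needed. The leading coefficient is 1 because a
      single letter has \<open>pair_weight\<close> 0.\<close>
    have half: "word v - ((-1) ^ (length v - 1) * q powi pair_weight v) \<cdot> word (rev v) \<in> U q"
      if v: "v \<in> W" "length v = length w" for v
    proof -
      obtain a v' where [simp]: "v = a # v'"
        using v 3 by (cases v) auto
      have "shuffle_words q (rev (take k v') @ [a]) (drop k v') \<in> U q" if "k < length v'" for k
      proof -
        \<comment> \<open>The shift to \<open>Suc k\<close> absorbs the first letter
          \<open>a\<close>, so both factors are proper and the induction hypothesis applies.\<close>
        have "word (rev (take (Suc k) v)) \<in> U q" "word (drop (Suc k) v) \<in> U q"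
          using "1.IH" closed v that by (simp_all del: take_Suc_Cons drop_Suc_Cons)
        then have "shuffle_words q (rev (take (Suc k) v)) (drop (Suc k) v) \<in> U q"
          unfolding qshuffle_word[symmetric] by (rule U.qshuffle)
        then show ?thesis
          by simp
      qed
      from antipode_mod_U[OF q(1) this] show ?thesis
        using pair_weight_rev[of v]
        by (cases a) (simp_all add: pair_weight_def[of "[_]"] letter_sign_def flip: word_append)
    qed
    have "word w - c \<cdot> word (rev w) \<in> U q" "word (rev w) - c \<cdot> word w \<in> U q"
      using half[of w] half[of "rev w"] closed(3) "1.prems" by (simp_all add: c_def pair_weight_rev)
    \<comment> \<open>Adding \<open>c\<close> times the relation for \<open>rev w\<close> eliminates
      \<open>rev w\<close>.\<close>
    then have "(word w - c \<cdot> word (rev w)) + c \<cdot> (word (rev w) - c \<cdot> word w) \<in> U q"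
      by (intro U.add U.smult)
    moreover have "(word w - c \<cdot> word (rev w)) + c \<cdot> (word (rev w) - c \<cdot> word w) = (1 - c\<^sup>2) \<cdot> word w"
      by (rule poly_mapping_eqI) (simp add: lookup_add lookup_minus power2_eq_square algebra_simps)
    ultimately have "(1 - c\<^sup>2) \<cdot> word w \<in> U q"
      by simp
    then have "inverse (1 - c\<^sup>2) \<cdot> (1 - c\<^sup>2) \<cdot> word w \<in> U q"
      by (rule U.smult)
    \<comment> \<open>Squaring removes the sign, leaving a power of \<open>q\<close> with nonzero
      exponent.\<close>
    moreover have "c\<^sup>2 = q powi (2 * pair_weight w)"
      using power_int_mult[of q "pair_weight w" 2]
      by (simp add: c_def power_mult_distrib mult.commute flip: power_mult)
    then have "c\<^sup>2 \<noteq> 1"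
      using powi_neq_1[OF q(2)] nonzero[OF "1.prems" 3] by simp
    ultimately show ?thesis
      by (simp add: smult_smult)
  qed
qed

section \<open>Factors of the periodic word ...xxyyxxyy..., described locally\<close>

definition doubly_alternating :: "letter list \<Rightarrow> bool"
  where "doubly_alternating w \<longleftrightarrow> (\<forall>i. i + 2 < length w \<longrightarrow> w ! i \<noteq> w ! (i + 2))"

lemma doubly_alternating_simps [simp]:
  "doubly_alternating []" "doubly_alternating [a]" "doubly_alternating [a, b]"
  "doubly_alternating (a # b # c # w) \<longleftrightarrow> a \<noteq> c \<and> doubly_alternating (b # c # w)"
proof -
  show "doubly_alternating (a # b # c # w) \<longleftrightarrow> a \<noteq> c \<and> doubly_alternating (b # c # w)"
    by (auto simp: doubly_alternating_def nth_Cons split: nat.splits)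
qed (simp_all add: doubly_alternating_def)

lemma doubly_alternating_take: "doubly_alternating w \<Longrightarrow> doubly_alternating (take k w)"
  by (simp add: doubly_alternating_def)

lemma doubly_alternating_drop: "doubly_alternating w \<Longrightarrow> doubly_alternating (drop k w)"
  by (simp add: doubly_alternating_def add.assoc)

lemma doubly_alternating_rev:
  assumes "doubly_alternating w"
  shows "doubly_alternating (rev w)"
  unfolding doubly_alternating_def
proof (intro allI impI)
  fix i assume i: "i + 2 < length (rev w)"
  then have "w ! (length w - (i + 3)) \<noteq> w ! (length w - (i + 3) + 2)"
    using assms by (simp add: doubly_alternating_def)
  moreover have "length w - (i + 3) + 2 = length w - Suc i"
    using i by simp
  ultimately show "rev w ! i \<noteq> rev w ! (i + 2)"
    using i by (simp add: rev_nth numeral_eq_Suc)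
qed

text \<open>The first and third letters cancel, and so do the second and fourth.\<close>

lemma weight_four:
  assumes "doubly_alternating (a # b # c # d # w)"
  shows "weight (a # b # c # d # w) = weight w"
  using assms by (cases a; cases b; cases c; cases d) (auto simp: letter_sign_def)

lemma abs_weight_le: "doubly_alternating w \<Longrightarrow> \<bar>weight w\<bar> \<le> 2"
proof (induction w rule: length_induct)
  case (1 w)
  consider a b c d v where "w = a # b # c # d # v" | "w = []" | a where "w = [a]"
    | a b where "w = [a, b]" | a b c where "w = [a, b, c]"
    by (metis list.exhaust)
  then show ?case
  proof cases
    case (1 a b c d v)
    then have "doubly_alternating v"
      using doubly_alternating_drop[OF "1.prems", of 4] by simp
    then show ?thesis
      using 1 "1.IH" "1.prems" weight_four[of a b c d v] by (simp del: weight_simps)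
  next
    case (5 a b c)
    then show ?thesis
      using "1.prems" by (cases a; cases b; cases c) (auto simp: letter_sign_def)
  qed (auto simp: letter_sign_def)
qed

text \<open>From length 5 on, the squared weight is at most 4 and so below the length. Length 4 has
  weight 0, length 3 has squared weight 1, and length 2 has squared weight 0 or 4, never 2.\<close>

lemma pair_weight_nonzero:
  assumes "doubly_alternating w" "2 \<le> length w"
  shows "pair_weight w \<noteq> 0"
proof -
  consider a b c d v where "w = a # b # c # d # v"
    | a b where "w = [a, b]" | a b c where "w = [a, b, c]"
    using assms(2) by (cases w rule: remdups_adj.cases) (simp_all, metis list.exhaust)
  then show ?thesis
  proof cases
    case (1 a b c d v)
    have "(weight w)\<^sup>2 \<le> 2\<^sup>2"
      using abs_weight_le[OF assms(1)] by (simp only: abs_le_square_iff[symmetric])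
    then show ?thesis
      using 1 weight_four[of a b c d v] assms(1) by (cases v) (auto simp: pair_weight_def)
  next
    case (2 a b)
    then show ?thesis
      by (auto simp: pair_weight_def letter_sign_def)
  next
    case (3 a b c)
    then show ?thesis
      using assms(1) by (auto simp: pair_weight_def letter_sign_def)
  qed
qed

lemma doubly_alternating_in_U:
  fixes q :: "'a::field"
  assumes "q \<noteq> 0" "\<And>k::nat. k > 0 \<Longrightarrow> q ^ k \<noteq> 1" "doubly_alternating w"
  shows "word w \<in> U q"
  by (rule word_in_U[where W = "Collect doubly_alternating"])
    (simp_all add: assms doubly_alternating_take doubly_alternating_drop doubly_alternating_rev
      pair_weight_nonzero)

text \<open>The leading \<open>b # b\<close> keeps the junction with the preceding block visible to
  the induction.\<close>

lemma doubly_alternating_blocks: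
  assumes "a \<noteq> b" "doubly_alternating (b # b # t)"
  shows "doubly_alternating (b # b # concat (replicate n [a, a, b, b]) @ t)"
  using assms by (induction n) auto

lemma doubly_alternating_blocks':
  assumes "a \<noteq> b" "doubly_alternating (b # b # t)"
  shows "doubly_alternating (concat (replicate n [a, a, b, b]) @ t)"
  using doubly_alternating_drop[OF doubly_alternating_blocks[OF assms], of 2 n] by simp

text \<open>Turns xyy(xxyy)^n x of the second relation into x(yyxx)^n yyx, the form in which the
  induction produces it.\<close>

lemma blocks_shift:
  "b # b # concat (replicate n [a, a, b, b]) @ t = concat (replicate n [b, b, a, a]) @ b # b # t"
  by (induction n) simp_all

section \<open>The q-commutators with x, block by block\<close>

lemma qcommutator_word:
  "qcommutator q (word u) (word v)
    = q \<cdot> shuffle_words q u v - inverse q \<cdot> shuffle_words q v u"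
  by (simp add: qcommutator_def qshuffle_word)

lemma word_Cons: "word (a # w) = word [a] * word w"
  by (simp flip: word_append)

text \<open>The remainder is kept nonempty, as otherwise \<open>word [a]\<close> would be rewritten
  forever.\<close>

lemmas word_Cons_simps = word_Cons[of _ "_ # _"]

text \<open>Each product inserts x at every place, weighted by q to twice the weight of the suffix
  (x on the right) or of the prefix (x on the left). The three insertions around xx give one word,
  with coefficients q^3 - q^-1, 0 and q^-1 - q^3; between the two letters y the coefficient is 0.
  Later insertions do not see the block, which has weight 0.\<close>

lemma qcommutator_x_right_block:
  fixes q :: "'a::field"
  assumes "q \<noteq> 0" "weight v = 1"
  shows "qcommutator q (word ([X, X, Y, Y] @ v)) \<^bold>x
    = word [X, X, Y, Y] * qcommutator q (word v) \<^bold>x"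
  unfolding qcommutator_word using assms
  by (simp add: sum_pairing letter_sign_def word_Cons_simps word_Cons[of _ v] mult.assoc
      word_mult_smult distrib_left right_diff_distrib)
    (intro poly_mapping_eqI,
      simp add: lookup_add lookup_minus power_int_minus field_simps eval_nat_numeral)

text \<open>Here the insertions before and after yy have opposite coefficients but give different
  words; those inside yy and inside xx vanish.\<close>

lemma qcommutator_x_left_block:
  fixes q :: "'a::field"
  assumes "q \<noteq> 0" "weight v = - 1"
  shows "qcommutator q \<^bold>x (word ([Y, Y, X, X] @ v))
    = (q - q powi (- 3)) \<cdot> (word ([X, Y, Y, X, X] @ v) - word ([Y, Y, X, X, X] @ v))
      + word [Y, Y, X, X] * qcommutator q \<^bold>x (word v)"
  unfolding qcommutator_word using assms
  by (simp add: sum_pairing letter_sign_def word_Cons_simps word_Cons[of _ v] mult.assoc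
      word_mult_smult distrib_left right_diff_distrib)
    (intro poly_mapping_eqI,
      simp add: lookup_add lookup_minus power_int_minus field_simps eval_nat_numeral)

lemma qcommutator_x_right:
  fixes q :: "'a::field"
  assumes "q \<noteq> 0" "weight v = 1"
  shows "qcommutator q (word (concat (replicate n [X, X, Y, Y]) @ v)) \<^bold>x
    = word (concat (replicate n [X, X, Y, Y])) * qcommutator q (word v) \<^bold>x"
proof (induction n)
  case 0
  show ?case
    by (simp add: word_Nil)
next
  case (Suc n)
  have "weight (concat (replicate n [X, X, Y, Y]) @ v) = 1"
    using assms(2) by (induction n) (simp_all add: letter_sign_def)
  from qcommutator_x_right_block[OF assms(1) this] show ?case
    using Suc by (simp add: word_append[of "[X, X, Y, Y]" "concat _", simplified] mult.assoc)
qed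

text \<open>The boundary terms telescope: the negative one of each block cancels the leading word of
  the induction hypothesis. Only the outermost word and the correction \<open>f\<close> of the base
  case survive.\<close>

lemma qcommutator_x_left:
  fixes q :: "'a::field"
  assumes "q \<noteq> 0" "weight v = - 1"
    and base: "qcommutator q \<^bold>x (word v) = (q - q powi (- 3)) \<cdot> (word (X # v) - f)"
  shows "qcommutator q \<^bold>x (word (concat (replicate n [Y, Y, X, X]) @ v))
    = (q - q powi (- 3)) \<cdot>
      (word (X # concat (replicate n [Y, Y, X, X]) @ v) - word (concat (replicate n [Y, Y, X, X])) * f)"
proof (induction n)
  case 0
  show ?case
    using base by (simp add: word_Nil)
next
  case (Suc n)
  let ?v = "concat (replicate n [Y, Y, X, X]) @ v"
  have "weight ?v = - 1"
    using assms(2) by (induction n) (simp_all add: letter_sign_def)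
  from qcommutator_x_left_block[OF assms(1) this] Suc show ?case
    by (simp add: word_Cons_simps word_Cons[of _ ?v] word_Cons[of _ "concat _"] mult.assoc
      word_mult_smult right_diff_distrib smult_diff)
qed

theorem proposition4p5:
  fixes q :: "'a::field_char_0" and n :: nat
  assumes "q \<noteq> 0"
    and "\<And>k::nat. k > 0 \<Longrightarrow> q ^ k \<noteq> 1"
  shows
    "{(\<^bold>x * \<^bold>x * \<^bold>y * \<^bold>y) ^ n * \<^bold>x * \<^bold>x * \<^bold>y,
      (\<^bold>y * \<^bold>y * \<^bold>x * \<^bold>x) ^ n * \<^bold>y * \<^bold>y * \<^bold>x,
      \<^bold>x * \<^bold>y * \<^bold>y * (\<^bold>x * \<^bold>x * \<^bold>y * \<^bold>y) ^ n * \<^bold>x,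
      (\<^bold>y * \<^bold>y * \<^bold>x * \<^bold>x) ^ (n + 1),
      (\<^bold>x * \<^bold>x * \<^bold>y * \<^bold>y) ^ n * \<^bold>x,
      (\<^bold>x * \<^bold>x * \<^bold>y * \<^bold>y) ^ n * \<^bold>x * \<^bold>x,
      (\<^bold>y * \<^bold>y * \<^bold>x * \<^bold>x) ^ n * \<^bold>y,
      \<^bold>x * (\<^bold>y * \<^bold>y * \<^bold>x * \<^bold>x) ^ n * \<^bold>y} \<subseteq> U q
    \<and> qcommutator q ((\<^bold>x * \<^bold>x * \<^bold>y * \<^bold>y) ^ n * \<^bold>x * \<^bold>x * \<^bold>y) \<^bold>x = 0
    \<and> qcommutator q \<^bold>x ((\<^bold>y * \<^bold>y * \<^bold>x * \<^bold>x) ^ n * \<^bold>y * \<^bold>y * \<^bold>x)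
      = (q - q powi (- 3)) \<cdot>
          (\<^bold>x * \<^bold>y * \<^bold>y * (\<^bold>x * \<^bold>x * \<^bold>y * \<^bold>y) ^ n * \<^bold>x - (\<^bold>y * \<^bold>y * \<^bold>x * \<^bold>x) ^ (n + 1))
    \<and> qcommutator q ((\<^bold>x * \<^bold>x * \<^bold>y * \<^bold>y) ^ n * \<^bold>x) \<^bold>x
      = (q ^ 3 - inverse q) \<cdot> ((\<^bold>x * \<^bold>x * \<^bold>y * \<^bold>y) ^ n * \<^bold>x * \<^bold>x)
    \<and> qcommutator q \<^bold>x ((\<^bold>y * \<^bold>y * \<^bold>x * \<^bold>x) ^ n * \<^bold>y)
      = (q - q powi (- 3)) \<cdot> (\<^bold>x * (\<^bold>y * \<^bold>y * \<^bold>x * \<^bold>x) ^ n * \<^bold>y)"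
proof (intro conjI)
  let ?xy = "concat (replicate n [X, X, Y, Y])" and ?yx = "concat (replicate n [Y, Y, X, X])"
  have block_power_Suc: "word [Y, Y, X, X] ^ (n + 1) = (word (?yx @ [Y, Y, X, X]) :: 'a freealg)"
    by (simp only: power_add word_power) (simp flip: word_append)
  have shift: "[X, Y, Y] @ ?xy @ [X] = [X] @ ?yx @ [Y, Y, X]"
    by (simp add: blocks_shift)
  note to_word = block_power_Suc word_power[of _ n] word_append[symmetric] append.assoc append.simps
  note in_U = doubly_alternating_in_U[OF assms]
  \<comment> \<open>Two of the words have letters in front of their blocks. Here an extra x is
    prepended to fit the block lemma and then dropped.\<close>
  have "doubly_alternating (X # X # ?yx @ [Y])"
    by (rule doubly_alternating_blocks) simp_all
  then have "doubly_alternating (X # ?yx @ [Y])"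
    using doubly_alternating_drop[of _ 1] by fastforce
  moreover have "doubly_alternating (Y # Y # ?xy @ [X])"
    by (rule doubly_alternating_blocks) simp_all
  then have "doubly_alternating (X # Y # Y # ?xy @ [X])"
    by simp
  ultimately show "{(\<^bold>x * \<^bold>x * \<^bold>y * \<^bold>y) ^ n * \<^bold>x * \<^bold>x * \<^bold>y,
      (\<^bold>y * \<^bold>y * \<^bold>x * \<^bold>x) ^ n * \<^bold>y * \<^bold>y * \<^bold>x,
      \<^bold>x * \<^bold>y * \<^bold>y * (\<^bold>x * \<^bold>x * \<^bold>y * \<^bold>y) ^ n * \<^bold>x,
      (\<^bold>y * \<^bold>y * \<^bold>x * \<^bold>x) ^ (n + 1),
      (\<^bold>x * \<^bold>x * \<^bold>y * \<^bold>y) ^ n * \<^bold>x,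
      (\<^bold>x * \<^bold>x * \<^bold>y * \<^bold>y) ^ n * \<^bold>x * \<^bold>x,
      (\<^bold>y * \<^bold>y * \<^bold>x * \<^bold>x) ^ n * \<^bold>y,
      \<^bold>x * (\<^bold>y * \<^bold>y * \<^bold>x * \<^bold>x) ^ n * \<^bold>y} \<subseteq> U q"
    by (simp only: to_word insert_subset empty_subsetI)
      (intro conjI TrueI in_U doubly_alternating_blocks'; simp)
  have right: "qcommutator q (word [X, X, Y]) \<^bold>x = 0"
    "qcommutator q \<^bold>x \<^bold>x = (q ^ 3 - inverse q) \<cdot> word [X, X]"
    using assms(1)
    by (rule_tac [!] poly_mapping_eqI)
      (simp_all add: qcommutator_word word_mult_smult distrib_left lookup_add lookup_minus
        power_int_minus field_simps eval_nat_numeral flip: word_append)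
  \<comment> \<open>The base cases have correction \<open>f\<close> equal to yyxx and to 0
    respectively.\<close>
  have left: "qcommutator q \<^bold>x (word [Y, Y, X])
      = (q - q powi (- 3)) \<cdot> (word [X, Y, Y, X] - word [Y, Y, X, X])"
    "qcommutator q \<^bold>x \<^bold>y = (q - q powi (- 3)) \<cdot> (word [X, Y] - 0)"
    using assms(1)
    by (rule_tac [!] poly_mapping_eqI)
      (simp_all add: qcommutator_word word_mult_smult distrib_left lookup_add lookup_minus
        power_int_minus field_simps eval_nat_numeral flip: word_append)
  show "qcommutator q ((\<^bold>x * \<^bold>x * \<^bold>y * \<^bold>y) ^ n * \<^bold>x * \<^bold>x * \<^bold>y) \<^bold>x = 0"
    using qcommutator_x_right[OF assms(1), of "[X, X, Y]" n] right(1)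
    by (simp only: to_word) (simp add: letter_sign_def)
  show "qcommutator q ((\<^bold>x * \<^bold>x * \<^bold>y * \<^bold>y) ^ n * \<^bold>x) \<^bold>x
      = (q ^ 3 - inverse q) \<cdot> ((\<^bold>x * \<^bold>x * \<^bold>y * \<^bold>y) ^ n * \<^bold>x * \<^bold>x)"
    using qcommutator_x_right[OF assms(1), of "[X]" n] right(2)
    by (simp only: to_word) (simp add: letter_sign_def word_mult_smult flip: word_append)
  show "qcommutator q \<^bold>x ((\<^bold>y * \<^bold>y * \<^bold>x * \<^bold>x) ^ n * \<^bold>y * \<^bold>y * \<^bold>x)
      = (q - q powi (- 3)) \<cdot>
          (\<^bold>x * \<^bold>y * \<^bold>y * (\<^bold>x * \<^bold>x * \<^bold>y * \<^bold>y) ^ n * \<^bold>x - (\<^bold>y * \<^bold>y * \<^bold>x * \<^bold>x) ^ (n + 1))"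
    using qcommutator_x_left[OF assms(1) _ left(1), of n] shift
    by (simp only: to_word) (simp add: letter_sign_def flip: word_append)
  show "qcommutator q \<^bold>x ((\<^bold>y * \<^bold>y * \<^bold>x * \<^bold>x) ^ n * \<^bold>y)
      = (q - q powi (- 3)) \<cdot> (\<^bold>x * (\<^bold>y * \<^bold>y * \<^bold>x * \<^bold>x) ^ n * \<^bold>y)"
    using qcommutator_x_left[OF assms(1) _ left(2), of n]
    by (simp only: to_word) (simp add: letter_sign_def)
qed

end
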